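(* Let $N_0\ge 1$ and let the coupling be $j=j_{\rm crit}(N_0)$. (a) The probability $P^{(PQ)}(T,M)$ that the quenched magnetization at stage $T$ equals $M$ is the canonical equilibrium weight of the event that the group of spins $\{s_1,\dots,s_T\}$ has magnetization $M$, i.e. $$P^{(PQ)}(T,M)=\Pr{}^{(\mathrm{eq})}\Big(\sum_{i=1}^{T}s_i=M\Big),$$ if, and only if, the progressive quenching starts from the unbiased initial condition, namely $M_{T=0}=0$ with probability one (no spin quenched at the start, the whole system being in equilibrium). (b) By contrast, if $T_0$ spins have already been quenched with magnetization $M_0$, then for $T\ge T_0$ the propagator retains a persistent memory of this start: it coincides with the constrained canonical weight of the event that $\{s_1,\dots,s_T\}$ has magnetization $M$ under the constraint that its subset $\{s_{i_1},\dots,s_{i_{T_0}}\}\subset\{s_1,\dots,s_T\}$ has magnetization $M_0$, i.e. $$P^{(PQ)}(T,M;T_0,M_0)=\Pr{}^{(\mathrm{eq})}\Big(\sum_{i=1}^{T}s_i=M\ \Big|\ \sum_{l=1}^{T_0}s_{i_l}=M_0\Big).$$ Consistently with this constraint, as a function of $M$ the propagator has the strict support $|M-M_0|\le T-T_0$.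
   Context: Model. $N_0$ Ising spins $s_1,\dots,s_{N_0}\in\{-1,+1\}$ sit on the complete graph with energy (inverse temperature absorbed in $j$) $H=-\frac{j}{N_0}\sum_{1\le i<k\le N_0}s_is_k$. $\Pr^{(\mathrm{eq})}$ is the canonical (Gibbs) distribution on $\{-1,1\}^{N_0}$ with weights proportional to $e^{-H}$. The value $j_{\rm crit}(N_0)$ is the "critical point" of the finite system, i.e. the coupling that maximizes its magnetic susceptibility, determined numerically from Curie's law; it tends to $1$ as $N_0\to\infty$. At stage $T$ ($0\le T\le N_0$), $T$ spins are quenched (frozen at the values they took), with sum $M\in\{-T,-T+2,\dots,T\}$, called the quenched magnetization. For $T\le N_0-1$ the $N=N_0-T$ unquenched spins $\sigma_1,\dots,\sigma_N$ are in equilibrium under the field $\frac{j}{N_0}M$ exerted by the quenched ones, with probability proportional to $$\exp\Big(\tfrac{j}{N_0}\sum_{1\le i<k\le N}\sigma_i\sigma_k+\tfrac{jM}{N_0}\sum_{i=1}^{N}\sigma_i\Big),\qquad \sigma\in\{-1,1\}^N,$$ and $m^{(\mathrm{eq})}_{T,M}$ denotes the expectation of $\sigma_1$ (equivalently, of any one unquenched spin) under this distribution. Progressive quenching (PQ) freezes the spins one after another, quasi-statically; the quenched magnetization is the Markov chain $(M_T)$ with $M_{T+1}=M_T\pm1$, where, given $M_T=M$, the increments $+1$ and $-1$ have probabilities $\frac{1+m^{(\mathrm{eq})}_{T,M}}{2}$ and $\frac{1-m^{(\mathrm{eq})}_{T,M}}{2}$. $P^{(PQ)}(T,M)$ is the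 probability that $M_T=M$ for the PQ with its given starting condition. $P^{(PQ)}(T,M;T_0,M_0)$, with $0\le T_0\le T\le N_0$, is the conditional probability that $M_T=M$ given the start $M_{T_0}=M_0$ at stage $T_0$, so that $P^{(PQ)}(T_0,M;T_0,M_0)=\delta_{M,M_0}$. The starting conditions contrasted with the unbiased one in the "only if" part of (a) are those where the first quenched spin $s_1$ has a law other than its equilibrium law $\Pr^{(\mathrm{eq})}(s_1)$, or where some spins $s_1,\dots,s_{n_0}$ are prefixed; the progression of PQ then carries a non-volatile memory that prevents relaxation to the canonical weight. *)

theory Defs
  imports "HOL-Probability.Probability"
begin

(* The coupling j is an arbitrary real throughout.  The critical coupling j_crit(N0) is only
   specified numerically (from Curie's law), and the zero-field susceptibility <M^2>/N0 of the
   finite system is increasing in j, so a literal maximizer need not exist.  Results stated for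
   every real j hold for j = j_crit(N0) however that number is determined. *)

definition spin_configs :: "nat \<Rightarrow> (nat \<Rightarrow> int) set" where
  "spin_configs n = {1..n} \<rightarrow>\<^sub>E {-1, 1}"

(* L is the logarithm of the unnormalized weight, i.e. minus the (reduced) energy. *)
definition boltzmann :: "nat \<Rightarrow> ((nat \<Rightarrow> int) \<Rightarrow> real) \<Rightarrow> (nat \<Rightarrow> int) pmf" where
  "boltzmann n L = embed_pmf (\<lambda>s. if s \<in> spin_configs n
     then exp (L s) / (\<Sum>t\<in>spin_configs n. exp (L t)) else 0)"

lemma finite_spin_configs: "finite (spin_configs n)"
  by (simp add: spin_configs_def finite_PiE)

lemma spin_configs_nonempty: "spin_configs n \<noteq> {}"
  by (simp add: spin_configs_def PiE_eq_empty_iff)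

lemma pmf_boltzmann:
  "pmf (boltzmann n L) s = (if s \<in> spin_configs n
     then exp (L s) / (\<Sum>t\<in>spin_configs n. exp (L t)) else 0)"
proof -
  define Z where "Z = (\<Sum>t\<in>spin_configs n. exp (L t))"
  have Z: "Z > 0"
    unfolding Z_def by (intro sum_pos finite_spin_configs spin_configs_nonempty) auto
  let ?f = "\<lambda>s. if s \<in> spin_configs n then exp (L s) / Z else 0"
  have "(\<integral>\<^sup>+s. ennreal (?f s) \<partial>count_space UNIV) = (\<Sum>s\<in>spin_configs n. ennreal (?f s))"
    by (rule nn_integral_count_space'[OF finite_spin_configs]) auto
  also have "\<dots> = ennreal (\<Sum>s\<in>spin_configs n. exp (L s) / Z)"
    using Z by (subst sum_ennreal[symmetric]) auto
  also have "(\<Sum>s\<in>spin_configs n. exp (L s) / Z) = 1"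
    using Z by (simp add: sum_divide_distrib[symmetric] Z_def[symmetric])
  finally have "(\<integral>\<^sup>+s. ennreal (?f s) \<partial>count_space UNIV) = 1"
    by simp
  moreover have "0 \<le> ?f s" for s
    using Z by simp
  ultimately have "pmf (embed_pmf ?f) s = ?f s"
    by (intro pmf_embed_pmf) auto
  then show ?thesis
    unfolding boltzmann_def Z_def .
qed

definition pair_sum :: "nat \<Rightarrow> (nat \<Rightarrow> int) \<Rightarrow> real" where
  "pair_sum n s = (\<Sum>k = 1..n. \<Sum>i = 1..<k. real_of_int (s i * s k))"

definition energy :: "real \<Rightarrow> nat \<Rightarrow> (nat \<Rightarrow> int) \<Rightarrow> real" where
  "energy j N0 s = - (j / real N0) * pair_sum N0 s"

definition gibbs :: "real \<Rightarrow> nat \<Rightarrow> (nat \<Rightarrow> int) pmf" where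
  "gibbs j N0 = boltzmann N0 (\<lambda>s. - energy j N0 s)"

(* Law of the N0 - T unquenched spins, relabelled 1, ..., N0 - T. *)
definition unquenched_gibbs :: "real \<Rightarrow> nat \<Rightarrow> nat \<Rightarrow> int \<Rightarrow> (nat \<Rightarrow> int) pmf" where
  "unquenched_gibbs j N0 T M = boltzmann (N0 - T)
     (\<lambda>\<sigma>. j / real N0 * pair_sum (N0 - T) \<sigma>
          + j * real_of_int M / real N0 * (\<Sum>i = 1..N0 - T. real_of_int (\<sigma> i)))"

(* Only meaningful for T < N0. *)
definition m_eq :: "real \<Rightarrow> nat \<Rightarrow> nat \<Rightarrow> int \<Rightarrow> real" where
  "m_eq j N0 T M = measure_pmf.expectation (unquenched_gibbs j N0 T M) (\<lambda>\<sigma>. real_of_int (\<sigma> 1))"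

definition pq_step :: "real \<Rightarrow> nat \<Rightarrow> nat \<Rightarrow> int \<Rightarrow> int pmf" where
  "pq_step j N0 T M = map_pmf (\<lambda>up. if up then M + 1 else M - 1)
     (bernoulli_pmf ((1 + m_eq j N0 T M) / 2))"

lemma abs_m_eq_le_1:
  assumes "T < N0"
  shows "\<bar>m_eq j N0 T M\<bar> \<le> 1"
proof -
  let ?p = "unquenched_gibbs j N0 T M"
  have *: "\<bar>real_of_int (\<sigma> 1)\<bar> \<le> 1" if "\<sigma> \<in> set_pmf ?p" for \<sigma>
  proof -
    have "\<sigma> \<in> spin_configs (N0 - T)"
      using that by (auto simp: set_pmf_iff unquenched_gibbs_def pmf_boltzmann split: if_splits)
    then have "\<sigma> 1 \<in> {-1, 1}"
      using assms by (auto simp: spin_configs_def PiE_def Pi_def)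
    then show ?thesis by auto
  qed
  have "integrable (measure_pmf ?p) (\<lambda>\<sigma>. real_of_int (\<sigma> 1))"
    by (rule measure_pmf.integrable_const_bound[where B = 1])
       (use * in \<open>auto simp: AE_measure_pmf_iff\<close>)
  moreover have "\<And>\<sigma>. \<sigma> \<in> set_pmf ?p \<Longrightarrow> real_of_int (\<sigma> 1) \<le> 1 \<and> - 1 \<le> real_of_int (\<sigma> 1)"
    using * by (simp add: abs_le_iff)
  ultimately have "m_eq j N0 T M \<le> 1" and "- 1 \<le> m_eq j N0 T M"
    unfolding m_eq_def
    by (auto intro!: measure_pmf.integral_le_const measure_pmf.integral_ge_const
        simp: AE_measure_pmf_iff simp del: of_int_le_1_iff)
  then show ?thesis
    by (simp add: abs_le_iff)
qed

(* Shows that bernoulli_pmf's clamping of its parameter to [0,1] plays no role. *)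
lemma pmf_pq_step:
  assumes "T < N0"
  shows "pmf (pq_step j N0 T M) (M + 1) = (1 + m_eq j N0 T M) / 2"
    and "pmf (pq_step j N0 T M) (M - 1) = (1 - m_eq j N0 T M) / 2"
proof -
  have inj: "inj (\<lambda>up. if up then M + 1 else M - 1)"
    by (auto simp: inj_def)
  have "0 \<le> (1 + m_eq j N0 T M) / 2" "(1 + m_eq j N0 T M) / 2 \<le> 1"
    using abs_m_eq_le_1[OF assms, of j M] by (auto simp: abs_le_iff)
  then show "pmf (pq_step j N0 T M) (M + 1) = (1 + m_eq j N0 T M) / 2"
    and "pmf (pq_step j N0 T M) (M - 1) = (1 - m_eq j N0 T M) / 2"
    using pmf_map_inj'[OF inj, of _ True] pmf_map_inj'[OF inj, of _ False]
    by (simp_all add: pq_step_def field_simps)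
qed

(* Law of the quenched magnetization after n further steps from magnetization M0 at stage T0. *)
primrec pq_run :: "real \<Rightarrow> nat \<Rightarrow> nat \<Rightarrow> int \<Rightarrow> nat \<Rightarrow> int pmf" where
  "pq_run j N0 T0 M0 0 = return_pmf M0"
| "pq_run j N0 T0 M0 (Suc n) = bind_pmf (pq_run j N0 T0 M0 n) (pq_step j N0 (T0 + n))"

(* P^(PQ)(T, . ; T0, M0), for T0 \<le> T \<le> N0. *)
definition pq_propagator :: "real \<Rightarrow> nat \<Rightarrow> nat \<Rightarrow> int \<Rightarrow> nat \<Rightarrow> int pmf" where
  "pq_propagator j N0 T0 M0 T = pq_run j N0 T0 M0 (T - T0)"

datatype pq_start =
    Unbiased                  (* M_0 = 0, no spin quenched *)
  | First_spin "int pmf"      (* s_1 drawn from the given law *)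
  | Prefixed "int list"       (* s_1, ..., s_n fixed to the listed values *)

(* P^(PQ)(T, .) for a given start. *)
fun pq_law :: "real \<Rightarrow> nat \<Rightarrow> pq_start \<Rightarrow> nat \<Rightarrow> int pmf" where
  "pq_law j N0 Unbiased T = pq_propagator j N0 0 0 T"
| "pq_law j N0 (First_spin q) T =
     (if T = 0 then return_pmf 0 else bind_pmf q (\<lambda>x. pq_propagator j N0 1 x T))"
| "pq_law j N0 (Prefixed xs) T =
     (if T \<le> length xs then return_pmf (sum_list (take T xs))
      else pq_propagator j N0 (length xs) (sum_list xs) T)"

(* The unbiased start and the biased ones it is contrasted with.  First_spin with the
   equilibrium law is excluded: it produces the same process as Unbiased. *)
fun admissible_start :: "real \<Rightarrow> nat \<Rightarrow> pq_start \<Rightarrow> bool" where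
  "admissible_start j N0 Unbiased \<longleftrightarrow> True"
| "admissible_start j N0 (First_spin q) \<longleftrightarrow>
     set_pmf q \<subseteq> {-1, 1} \<and> q \<noteq> map_pmf (\<lambda>s. s 1) (gibbs j N0)"
| "admissible_start j N0 (Prefixed xs) \<longleftrightarrow>
     xs \<noteq> [] \<and> length xs \<le> N0 \<and> set xs \<subseteq> {-1, 1}"

definition quenched_mags :: "nat \<Rightarrow> int set" where
  "quenched_mags T = {2 * int k - int T | k. k \<le> T}"

end

theory Submission imports Defs begin

text \<open>
  On the complete graph the weight of a configuration depends only on its total magnetization
  \<open>S\<close>: it is proportional to \<open>h(S) = exp (j S\<^sup>2 / (2 N0))\<close>.  Let \<open>Z(T, M)\<close> be the sum of
  \<open>h(M + \<Sum>\<sigma>)\<close> over the \<open>N0 - T\<close> unquenched spins.  Then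
  \<open>Z(T, M) = Z(T + 1, M + 1) + Z(T + 1, M - 1)\<close>, and the probability of an up-step is
  \<open>Z(T + 1, M + 1) / Z(T, M)\<close>.  So progressive quenching is the Doob transform of the simple
  random walk by \<open>Z\<close>: the propagator is the number of walks from \<open>M0\<close> to \<open>M\<close> times
  \<open>Z(T, M) / Z(T0, M0)\<close>, and this is also the constrained canonical weight.
  The uniqueness of the unbiased start is read off at the extreme magnetizations \<open>\<plusminus>T\<close>.
\<close>

section \<open>Sums over the endpoints of simple random walks\<close>

primrec walk_sum :: "nat \<Rightarrow> (int \<Rightarrow> real) \<Rightarrow> int \<Rightarrow> real" where
  "walk_sum 0 f x = f x"
| "walk_sum (Suc n) f x = walk_sum n f (x + 1) + walk_sum n f (x - 1)"

lemma walk_sum_add: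
  "walk_sum n (\<lambda>y. f y + g y) x = walk_sum n f x + walk_sum n g x"
  by (induction n arbitrary: x) (simp_all add: algebra_simps)

lemma walk_sum_shift: "walk_sum n (\<lambda>y. f (y + a)) x = walk_sum n f (x + a)"
  by (induction n arbitrary: x) (simp_all add: algebra_simps)

lemma walk_sum_mult_right: "walk_sum n (\<lambda>y. f y * c) x = walk_sum n f x * c"
  by (induction n arbitrary: x) (simp_all add: algebra_simps)

text \<open>The defining recursion peels off the first step of the walk. Since steps commute with
  translations, the last step can be peeled off instead; this is the form needed when a spin or a
  time step is appended.\<close>

lemma walk_sum_Suc_inner:
  "walk_sum (Suc n) f x = walk_sum n (\<lambda>y. f (y + 1) + f (y - 1)) x"
  using walk_sum_shift[of n f 1 x] walk_sum_shift[of n f "-1" x]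
  by (simp add: walk_sum_add)

lemma walk_sum_pos: "(\<And>y. f y > 0) \<Longrightarrow> walk_sum n f x > 0"
  by (induction n arbitrary: x) (simp_all add: add_pos_pos)

text \<open>A binomial coefficient, extended by 0 to unreachable endpoints. Writing it as a
  \<open>walk_sum\<close> of an indicator lets it come out of spin sums directly; it is real because
  it multiplies Boltzmann weights.\<close>

definition walk_count :: "nat \<Rightarrow> int \<Rightarrow> int \<Rightarrow> real" where
  "walk_count n x y = walk_sum n (\<lambda>z. if z = y then 1 else 0) x"

lemma walk_count_0: "walk_count 0 x y = (if x = y then 1 else 0)"
  by (simp add: walk_count_def)

lemma walk_count_Suc:
  "walk_count (Suc n) x y = walk_count n (x + 1) y + walk_count n (x - 1) y"
  by (simp add: walk_count_def)

lemma walk_count_Suc_inner: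
  "walk_count (Suc n) x y = walk_count n x (y - 1) + walk_count n x (y + 1)"
proof -
  have "(\<lambda>z. (if z + 1 = y then 1 else 0) + (if z - 1 = y then 1 else 0)) =
        (\<lambda>z. (if z = y - 1 then 1 else 0) + (if z = y + 1 then 1 else (0 :: real)))"
    by (intro ext arg_cong2[where f = "(+)"] if_cong refl) auto
  then show ?thesis
    unfolding walk_count_def walk_sum_Suc_inner by (simp add: walk_sum_add)
qed

lemma walk_count_nonneg: "walk_count n x y \<ge> 0"
  by (induction n arbitrary: x) (simp_all add: walk_count_0 walk_count_Suc)

text \<open>The two terms of the recursion are nonnegative and cannot cancel, so a point is
  reachable iff it is reachable from one of the two neighbours of the start.\<close>

lemma walk_count_eq_0_iff:
  "walk_count n x y = 0 \<longleftrightarrow> \<not> (\<bar>y - x\<bar> \<le> int n \<and> even (y - x + int n))"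
proof (induction n arbitrary: x)
  case 0
  then show ?case by (auto simp: walk_count_0)
next
  case (Suc n)
  have "walk_count (Suc n) x y = 0 \<longleftrightarrow> walk_count n (x + 1) y = 0 \<and> walk_count n (x - 1) y = 0"
    using walk_count_nonneg by (simp add: walk_count_Suc add_nonneg_eq_0_iff)
  also have "\<dots> \<longleftrightarrow> \<not> (\<bar>y - x\<bar> \<le> int (Suc n) \<and> even (y - x + int (Suc n)))"
  proof -
    have "even (y - (x + 1) + int n) \<longleftrightarrow> even (y - x + int (Suc n))"
      "even (y - (x - 1) + int n) \<longleftrightarrow> even (y - x + int (Suc n))"
      by auto
    moreover have "\<bar>y - (x + 1)\<bar> \<le> int n \<or> \<bar>y - (x - 1)\<bar> \<le> int n"
      if "\<bar>y - x\<bar> \<le> int (Suc n)" "even (y - x + int (Suc n))"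
    proof -
      \<comment> \<open>A step towards \<open>y\<close> shortens the distance by one, except when
        \<open>y = x\<close>. Then both steps lead to distance 1, which is within range because
        parity excludes \<open>n = 0\<close>.\<close>
      have "n \<noteq> 0" if "y = x"
        using that \<open>even (y - x + int (Suc n))\<close> by (cases n) auto
      then show ?thesis
        using that(1) by linarith
    qed
    moreover have "\<bar>y - x\<bar> \<le> int (Suc n)"
      if "\<bar>y - (x + 1)\<bar> \<le> int n \<or> \<bar>y - (x - 1)\<bar> \<le> int n"
      using that by linarith
    ultimately show ?thesis
      unfolding Suc.IH by blast
  qed
  finally show ?case .
qed

text \<open>Only the walk whose steps all equal \<open>x\<close> gets this far: after a first step
  \<open>- x\<close> the target is at distance \<open>n + 2\<close> with \<open>n\<close> steps
  left.\<close>

lemma walk_count_extreme: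
  assumes "x \<in> {-1, 1}"
  shows "walk_count n a (a + x * int n) = 1"
proof (induction n arbitrary: a)
  case 0
  then show ?case by (simp add: walk_count_0)
next
  case (Suc n)
  have "walk_count n (a - x) (a + x * int (Suc n)) = 0"
    using assms by (auto simp: walk_count_eq_0_iff)
  moreover have "walk_count n (a + x) (a + x * int (Suc n)) = 1"
    using Suc[of "a + x"] by (simp add: algebra_simps)
  ultimately show ?case
    using assms by (auto simp: walk_count_Suc)
qed

section \<open>Spin sums over disjoint blocks as walk sums\<close>

lemma sum_PiE_insert:
  fixes F :: "('a \<Rightarrow> int) \<Rightarrow> real"
  assumes "a \<notin> I"
  shows "(\<Sum>s\<in>insert a I \<rightarrow>\<^sub>E {-1, 1}. F s) =
         (\<Sum>s\<in>I \<rightarrow>\<^sub>E {-1, 1}. F (s(a := 1)) + F (s(a := -1)))"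
proof -
  have "(\<Sum>s\<in>insert a I \<rightarrow>\<^sub>E {-1, 1}. F s) =
        (\<Sum>(x, s)\<in>{-1, 1} \<times> (I \<rightarrow>\<^sub>E {-1, 1}). F (s(a := x)))"
    using sum.reindex[OF inj_combinator[OF assms, of "\<lambda>_. {-1, 1}"], of F]
    by (simp add: PiE_insert_eq case_prod_beta comp_def)
  also have "\<dots> = (\<Sum>x\<in>{-1, 1}. \<Sum>s\<in>I \<rightarrow>\<^sub>E {-1, 1}. F (s(a := x)))"
    by (simp only: sum.cartesian_product)
  also have "\<dots> = (\<Sum>s\<in>I \<rightarrow>\<^sub>E {-1, 1}. F (s(a := 1)) + F (s(a := -1)))"
    by (simp add: sum.distrib)
  finally show ?thesis .
qed

text \<open>The spins in \<open>B\<close> enter only through their sum, so each of them acts as one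
  walk step. The induction keeps \<open>F\<close> arbitrary: summing out one spin replaces
  \<open>F s y\<close> by \<open>F s (y + 1) + F s (y - 1)\<close>.\<close>

lemma sum_PiE_Un:
  fixes F :: "('a \<Rightarrow> int) \<Rightarrow> int \<Rightarrow> real"
  assumes "finite B" "A \<inter> B = {}"
  shows "(\<Sum>s\<in>A \<union> B \<rightarrow>\<^sub>E {-1, 1}. F (restrict s A) (\<Sum>i\<in>B. s i)) =
         (\<Sum>s\<in>A \<rightarrow>\<^sub>E {-1, 1}. walk_sum (card B) (F s) 0)"
  using assms
proof (induction B arbitrary: F rule: finite_induct)
  case empty
  show ?case
    by (rule sum.cong) (auto simp: PiE_restrict)
next
  case (insert b B)
  have upd: "F (restrict (s(b := x)) A) (\<Sum>i\<in>insert b B. (s(b := x)) i) =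
      F (restrict s A) ((\<Sum>i\<in>B. s i) + x)" for s x
  proof -
    have "(\<Sum>i\<in>B. (s(b := x)) i) = (\<Sum>i\<in>B. s i)"
      using insert.hyps by (intro sum.cong) auto
    moreover have "restrict (s(b := x)) A = restrict s A"
      using insert.prems by (auto simp: restrict_def)
    ultimately show ?thesis
      using insert.hyps by (simp add: add.commute)
  qed
  have "b \<notin> A \<union> B" "A \<inter> B = {}"
    using insert.hyps insert.prems by auto
  then have "(\<Sum>s\<in>A \<union> insert b B \<rightarrow>\<^sub>E {-1, 1}. F (restrict s A) (\<Sum>i\<in>insert b B. s i)) =
      (\<Sum>s\<in>A \<union> B \<rightarrow>\<^sub>E {-1, 1}. F (restrict s A) ((\<Sum>i\<in>B. s i) + 1)
         + F (restrict s A) ((\<Sum>i\<in>B. s i) - 1))"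
    using sum_PiE_insert[of b "A \<union> B" "\<lambda>s. F (restrict s A) (\<Sum>i\<in>insert b B. s i)"]
    unfolding upd by simp
  also have "\<dots> = (\<Sum>s\<in>A \<rightarrow>\<^sub>E {-1, 1}. walk_sum (card B) (\<lambda>y. F s (y + 1) + F s (y - 1)) 0)"
    using insert.IH[of "\<lambda>s y. F s (y + 1) + F s (y - 1)", OF \<open>A \<inter> B = {}\<close>] .
  also have "\<dots> = (\<Sum>s\<in>A \<rightarrow>\<^sub>E {-1, 1}. walk_sum (card (insert b B)) (F s) 0)"
    using insert.hyps by (simp add: walk_sum_Suc_inner del: walk_sum.simps)
  finally show ?case .
qed

lemma sum_PiE_sum:
  assumes "finite B"
  shows "(\<Sum>s\<in>B \<rightarrow>\<^sub>E {-1, 1}. f (\<Sum>i\<in>B. s i)) = walk_sum (card B) f 0"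
  using sum_PiE_Un[OF assms, of "{}" "\<lambda>_. f"] by simp

lemma sum_PiE_two_blocks:
  fixes f :: "int \<Rightarrow> real"
  assumes "finite A" "finite B" "A \<inter> B = {}"
  shows "(\<Sum>s\<in>A \<union> B \<rightarrow>\<^sub>E {-1, 1}.
            (if (\<Sum>i\<in>A. s i) = a then f (\<Sum>i\<in>A \<union> B. s i) else 0)) =
         walk_count (card A) 0 a * walk_sum (card B) f a"
proof -
  have "(\<Sum>s\<in>A \<union> B \<rightarrow>\<^sub>E {-1, 1}.
            (if (\<Sum>i\<in>A. s i) = a then f (\<Sum>i\<in>A \<union> B. s i) else 0)) =
        (\<Sum>s\<in>A \<union> B \<rightarrow>\<^sub>E {-1, 1}. (\<lambda>t y. (if (\<Sum>i\<in>A. t i) = a then 1 else 0) * f (y + a))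
            (restrict s A) (\<Sum>i\<in>B. s i))"
    using assms by (intro sum.cong) (auto simp: sum.union_disjoint add.commute)
  also have "\<dots> = (\<Sum>s\<in>A \<rightarrow>\<^sub>E {-1, 1}.
      walk_sum (card B) (\<lambda>y. (if (\<Sum>i\<in>A. s i) = a then 1 else 0) * f (y + a)) 0)"
    by (rule sum_PiE_Un) (use assms in auto)
  also have "\<dots> = (\<Sum>s\<in>A \<rightarrow>\<^sub>E {-1, 1}.
      (\<lambda>z. if z = a then 1 else 0) (\<Sum>i\<in>A. s i) * walk_sum (card B) f a)"
    \<comment> \<open>The instance with the zero function and factor 0 says that
      \<open>walk_sum\<close> of zero vanishes; it settles the configurations where the indicator is
      0.\<close>
    using walk_sum_shift[of "card B" f a 0] walk_sum_mult_right[of "card B" "\<lambda>_. 0" 0 0]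
    by (intro sum.cong) auto
  also have "\<dots> = walk_count (card A) 0 a * walk_sum (card B) f a"
    using sum_PiE_sum[OF assms(1), of "\<lambda>z. if z = a then 1 else 0"]
    by (simp add: sum_distrib_right[symmetric] walk_count_def)
  finally show ?thesis .
qed

text \<open>Summing out \<open>C\<close> first leaves a two-block sum whose weight is the indicator
  of the endpoint \<open>b\<close>. The blocks are thus successive walk segments, from 0 to
  \<open>a\<close>, from \<open>a\<close> to \<open>b\<close>, and from \<open>b\<close>
  onwards.\<close>

lemma sum_PiE_three_blocks:
  fixes f :: "int \<Rightarrow> real"
  assumes "finite A" "finite B" "finite C" "A \<inter> B = {}" "(A \<union> B) \<inter> C = {}"
  shows "(\<Sum>s\<in>A \<union> B \<union> C \<rightarrow>\<^sub>E {-1, 1}.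
            (if (\<Sum>i\<in>A \<union> B. s i) = b \<and> (\<Sum>i\<in>A. s i) = a then f (\<Sum>i\<in>A \<union> B \<union> C. s i) else 0)) =
         walk_count (card A) 0 a * walk_count (card B) a b * walk_sum (card C) f b"
proof -
  have "(\<Sum>s\<in>A \<union> B \<union> C \<rightarrow>\<^sub>E {-1, 1}.
          (if (\<Sum>i\<in>A \<union> B. s i) = b \<and> (\<Sum>i\<in>A. s i) = a then f (\<Sum>i\<in>A \<union> B \<union> C. s i) else 0)) =
        (\<Sum>s\<in>A \<union> B \<union> C \<rightarrow>\<^sub>E {-1, 1}.
          (\<lambda>t y. (if (\<Sum>i\<in>A \<union> B. t i) = b \<and> (\<Sum>i\<in>A. t i) = a then 1 else 0) * f (y + b))
            (restrict s (A \<union> B)) (\<Sum>i\<in>C. s i))"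
    using assms
    by (intro sum.cong) (auto simp: sum.union_disjoint[of "A \<union> B" C] add.commute)
  also have "\<dots> = (\<Sum>s\<in>A \<union> B \<rightarrow>\<^sub>E {-1, 1}. walk_sum (card C)
      (\<lambda>y. (if (\<Sum>i\<in>A \<union> B. s i) = b \<and> (\<Sum>i\<in>A. s i) = a then 1 else 0) * f (y + b)) 0)"
    by (rule sum_PiE_Un) (use assms in auto)
  also have "\<dots> = (\<Sum>s\<in>A \<union> B \<rightarrow>\<^sub>E {-1, 1}.
      (if (\<Sum>i\<in>A. s i) = a then (\<lambda>z. if z = b then 1 else 0) (\<Sum>i\<in>A \<union> B. s i) else 0)
        * walk_sum (card C) f b)"
    using walk_sum_shift[of "card C" f b 0] walk_sum_mult_right[of "card C" "\<lambda>_. 0" 0 0]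
    by (intro sum.cong) auto
  also have "\<dots> = walk_count (card A) 0 a * walk_count (card B) a b * walk_sum (card C) f b"
    using sum_PiE_two_blocks[OF assms(1,2,4), of a "\<lambda>z. if z = b then 1 else 0"]
    by (simp add: sum_distrib_right[symmetric] walk_count_def)
  finally show ?thesis .
qed

section \<open>Gibbs weights as functions of the total magnetization\<close>

lemma pair_sum_eq:
  assumes "\<And>i. i \<in> {1..n} \<Longrightarrow> s i \<in> {-1, 1}"
  shows "2 * pair_sum n s = (real_of_int (\<Sum>i = 1..n. s i))\<^sup>2 - real n"
  using assms
proof (induction n)
  case 0
  show ?case by (simp add: pair_sum_def)
next
  case (Suc n)
  \<comment> \<open>The diagonal terms of the squared sum are all 1; together they make up the
    subtracted \<open>real n\<close>.\<close>
  have sq: "(real_of_int (s (Suc n)))\<^sup>2 = 1"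
    using Suc.prems[of "Suc n"] by auto
  have "2 * pair_sum (Suc n) s =
      2 * pair_sum n s + 2 * (real_of_int (\<Sum>i = 1..n. s i) * real_of_int (s (Suc n)))"
    by (simp add: pair_sum_def atLeastLessThanSuc_atLeastAtMost sum_distrib_right)
  also have "2 * pair_sum n s = (real_of_int (\<Sum>i = 1..n. s i))\<^sup>2 - real n"
    using Suc by simp
  finally show ?case
    using sq by (simp add: power2_sum)
qed

text \<open>A constant in the exponent cancels against the normalization. Here \<open>k\<close>
  collects the part of the exponent that is the same for all configurations, so that
  \<open>W\<close> can be a function of the magnetization alone.\<close>

lemma expectation_boltzmann:
  assumes L: "\<And>s. s \<in> spin_configs n \<Longrightarrow> L s = k + W s"
  shows "measure_pmf.expectation (boltzmann n L) f =
         (\<Sum>s\<in>spin_configs n. f s * exp (W s)) / (\<Sum>s\<in>spin_configs n. exp (W s))"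
proof -
  let ?Z = "\<Sum>s\<in>spin_configs n. exp (W s)"
  have Z: "(\<Sum>s\<in>spin_configs n. exp (L s)) = exp k * ?Z"
    by (simp add: L exp_add sum_distrib_left)
  have "measure_pmf.expectation (boltzmann n L) f =
        (\<Sum>s\<in>spin_configs n. f s * pmf (boltzmann n L) s)"
    by (rule integral_measure_pmf_real[OF finite_spin_configs])
      (auto simp: set_pmf_iff pmf_boltzmann split: if_splits)
  also have "\<dots> = (\<Sum>s\<in>spin_configs n. f s * exp (W s) / ?Z)"
    by (intro sum.cong refl) (simp add: pmf_boltzmann Z, simp add: L exp_add)
  finally show ?thesis
    by (simp add: sum_divide_distrib)
qed

definition mag_weight :: "real \<Rightarrow> nat \<Rightarrow> int \<Rightarrow> real" where
  "mag_weight j N0 x = exp (j / (2 * real N0) * (real_of_int x)\<^sup>2)"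

text \<open>The \<open>Z(T, M)\<close> of the opening text; the steps of the walk stand for the
  unquenched spins.\<close>

definition partition_fun :: "real \<Rightarrow> nat \<Rightarrow> nat \<Rightarrow> int \<Rightarrow> real" where
  "partition_fun j N0 T M = walk_sum (N0 - T) (mag_weight j N0) M"

lemma partition_fun_pos: "partition_fun j N0 T M > 0"
  unfolding partition_fun_def by (rule walk_sum_pos) (simp add: mag_weight_def)

lemma partition_fun_rec:
  assumes "T < N0"
  shows "partition_fun j N0 T M =
         partition_fun j N0 (Suc T) (M + 1) + partition_fun j N0 (Suc T) (M - 1)"
proof -
  have "N0 - T = Suc (N0 - Suc T)"
    using assms by simp
  then show ?thesis
    by (simp add: partition_fun_def)
qed

lemma spin_configsD: "s \<in> spin_configs n \<Longrightarrow> i \<in> {1..n} \<Longrightarrow> s i \<in> {-1, 1}"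
  unfolding spin_configs_def by (rule PiE_mem)

lemma prob_gibbs:
  assumes "N0 \<ge> 1"
  shows "measure_pmf.prob (gibbs j N0) {s. P s} =
         (\<Sum>s\<in>spin_configs N0. if P s then mag_weight j N0 (\<Sum>i = 1..N0. s i) else 0)
           / partition_fun j N0 0 0"
proof -
  let ?W = "\<lambda>s. j / (2 * real N0) * (real_of_int (\<Sum>i = 1..N0. s i))\<^sup>2"
  have Z: "(\<Sum>s\<in>spin_configs N0. exp (?W s)) = partition_fun j N0 0 0"
    using sum_PiE_sum[of "{1..N0}" "mag_weight j N0"]
    by (simp add: partition_fun_def mag_weight_def spin_configs_def)
  have "measure_pmf.prob (gibbs j N0) {s. P s} =
        measure_pmf.expectation (gibbs j N0) (indicator {s. P s})"
    by simp
  also have "\<dots> = (\<Sum>s\<in>spin_configs N0. indicator {s. P s} s * exp (?W s))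
      / (\<Sum>s\<in>spin_configs N0. exp (?W s))"
    unfolding gibbs_def
  \<comment> \<open>The diagonal terms contribute \<open>- N0 / 2\<close> to the pair sum, hence
    \<open>- j / 2\<close> after multiplication by \<open>j / N0\<close>.\<close>
  proof (rule expectation_boltzmann[where k = "- j / 2"])
    fix s assume "s \<in> spin_configs N0"
    then have "2 * pair_sum N0 s = (real_of_int (\<Sum>i = 1..N0. s i))\<^sup>2 - real N0"
      by (intro pair_sum_eq spin_configsD)
    then have "pair_sum N0 s = ((real_of_int (\<Sum>i = 1..N0. s i))\<^sup>2 - real N0) / 2"
      by simp
    moreover have "j / real N0 * ((S - real N0) / 2) = - j / 2 + j / (2 * real N0) * S" for S
      using assms by (simp add: field_simps)
    ultimately show "- energy j N0 s = - j / 2 + ?W s"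
      by (simp only: energy_def mult_minus_left minus_minus)
  qed
  also have "\<dots> = (\<Sum>s\<in>spin_configs N0. if P s then mag_weight j N0 (\<Sum>i = 1..N0. s i) else 0)
      / partition_fun j N0 0 0"
    unfolding Z mag_weight_def
    by (intro arg_cong2[where f = "(/)"] sum.cong refl) (simp add: indicator_def)
  finally show ?thesis .
qed

section \<open>Progressive quenching as a Doob transform of the simple random walk\<close>

lemma m_eq_partition_fun:
  assumes "T < N0"
  shows "m_eq j N0 T M =
    (partition_fun j N0 (Suc T) (M + 1) - partition_fun j N0 (Suc T) (M - 1)) / partition_fun j N0 T M"
proof -
  let ?n = "N0 - T"
  let ?h = "mag_weight j N0"
  let ?W = "\<lambda>s. j / (2 * real N0) * (real_of_int ((\<Sum>i = 1..?n. s i) + M))\<^sup>2"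
  have Z: "(\<Sum>s\<in>spin_configs ?n. exp (?W s)) = partition_fun j N0 T M"
    using sum_PiE_sum[of "{1..?n}" "\<lambda>y. ?h (y + M)"] walk_sum_shift[of ?n ?h M 0]
    by (simp add: partition_fun_def mag_weight_def spin_configs_def)
  \<comment> \<open>Fixing spin 1 to a value \<open>x\<close> leaves one spin fewer, in the field of
    \<open>M + x\<close>: exactly the situation at stage \<open>Suc T\<close>.\<close>
  have split: "{1..?n} = insert 1 {2..?n}"
    using assms by auto
  have tail: "(\<Sum>s\<in>{2..?n} \<rightarrow>\<^sub>E {-1, 1}. ?h ((\<Sum>i = 2..?n. s i) + a)) =
      partition_fun j N0 (Suc T) a" for a
    using sum_PiE_sum[of "{2..?n}" "\<lambda>y. ?h (y + a)"] walk_sum_shift[of "?n - 1" ?h a 0]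
    by (simp add: partition_fun_def)
  have upd: "(\<Sum>i = 1..?n. (s(1 := x)) i) = (\<Sum>i = 2..?n. s i) + x" for s and x :: int
  proof -
    have "(\<Sum>i = 2..?n. (s(1 := x)) i) = (\<Sum>i = 2..?n. s i)"
      by (intro sum.cong) auto
    then show ?thesis
      unfolding split by simp
  qed
  have "(\<Sum>s\<in>spin_configs ?n. real_of_int (s 1) * exp (?W s)) =
        (\<Sum>s\<in>insert 1 {2..?n} \<rightarrow>\<^sub>E {-1, 1}. real_of_int (s 1) * ?h ((\<Sum>i = 1..?n. s i) + M))"
    unfolding spin_configs_def mag_weight_def split ..
  also have "\<dots> = (\<Sum>s\<in>{2..?n} \<rightarrow>\<^sub>E {-1, 1}.
      ?h ((\<Sum>i = 2..?n. s i) + (M + 1)) - ?h ((\<Sum>i = 2..?n. s i) + (M - 1)))"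
    by (subst sum_PiE_insert, simp, unfold upd) (simp add: algebra_simps)
  also have "\<dots> = partition_fun j N0 (Suc T) (M + 1) - partition_fun j N0 (Suc T) (M - 1)"
    by (simp only: sum_subtractf tail)
  finally have num: "(\<Sum>s\<in>spin_configs ?n. real_of_int (s 1) * exp (?W s)) = \<dots>" .
  have "m_eq j N0 T M = (\<Sum>s\<in>spin_configs ?n. real_of_int (s 1) * exp (?W s))
      / (\<Sum>s\<in>spin_configs ?n. exp (?W s))"
    unfolding m_eq_def unquenched_gibbs_def
  \<comment> \<open>This \<open>k\<close> comes from completing the square: the pair term and the
    field term combine to \<open>(S + M)^2\<close>, up to \<open>M^2\<close> and the diagonal
    terms.\<close>
  proof (rule expectation_boltzmann
      [where k = "- j / (2 * real N0) * (real ?n + (real_of_int M)\<^sup>2)"])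
    fix s assume "s \<in> spin_configs ?n"
    then have "2 * pair_sum ?n s = (real_of_int (\<Sum>i = 1..?n. s i))\<^sup>2 - real ?n"
      by (intro pair_sum_eq spin_configsD)
    then have pair: "pair_sum ?n s = ((real_of_int (\<Sum>i = 1..?n. s i))\<^sup>2 - real ?n) / 2"
      by simp
    define S where "S = real_of_int (\<Sum>i = 1..?n. s i)"
    define r where "r = real ?n"
    have "j / real N0 * ((S\<^sup>2 - r) / 2) + j * real_of_int M / real N0 * S =
      - j / (2 * real N0) * (r + (real_of_int M)\<^sup>2) + j / (2 * real N0) * (S + real_of_int M)\<^sup>2"
      using assms by (simp add: field_simps power2_eq_square)
    then show "j / real N0 * pair_sum ?n s
        + j * real_of_int M / real N0 * (\<Sum>i = 1..?n. real_of_int (s i)) =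
      - j / (2 * real N0) * (real ?n + (real_of_int M)\<^sup>2) + ?W s"
      unfolding pair S_def r_def by simp
  qed
  then show ?thesis
    unfolding num Z .
qed

text \<open>With \<open>Z = Zp + Zm\<close> and mean spin \<open>(Zp - Zm) / Z\<close>, the up and
  down probabilities become \<open>Zp / Z\<close> and \<open>Zm / Z\<close>. Stating this as a
  function of the target \<open>M'\<close> makes it ready for a sum over predecessors.\<close>

lemma pmf_pq_step_partition_fun:
  assumes "T < N0"
  shows "pmf (pq_step j N0 T M) M' = (if M' = M + 1 \<or> M' = M - 1
    then partition_fun j N0 (Suc T) M' / partition_fun j N0 T M else 0)"
proof -
  have Z: "partition_fun j N0 T M > 0"
    by (rule partition_fun_pos)
  have "M' \<notin> set_pmf (pq_step j N0 T M)" if "M' \<noteq> M + 1" "M' \<noteq> M - 1"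
    using that by (auto simp: pq_step_def split: if_splits)
  then have "pmf (pq_step j N0 T M) M' = 0" if "M' \<noteq> M + 1" "M' \<noteq> M - 1"
    using that by (simp add: set_pmf_iff)
  moreover have "(1 + m_eq j N0 T M) / 2 = partition_fun j N0 (Suc T) (M + 1) / partition_fun j N0 T M"
    "(1 - m_eq j N0 T M) / 2 = partition_fun j N0 (Suc T) (M - 1) / partition_fun j N0 T M"
    using Z partition_fun_rec[OF assms, of j M]
    by (simp_all add: m_eq_partition_fun[OF assms] field_simps)
  ultimately show ?thesis
    using pmf_pq_step[OF assms, of j M] by auto
qed

text \<open>Along every path the one-step ratios telescope to the same quotient of partition
  functions, so only the number of paths remains to be counted.\<close>

lemma pmf_pq_run:
  assumes "T0 + n \<le> N0"
  shows "pmf (pq_run j N0 T0 M0 n) M =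
         walk_count n M0 M * partition_fun j N0 (T0 + n) M / partition_fun j N0 T0 M0"
  using assms
proof (induction n arbitrary: M)
  case 0
  then show ?case
    using partition_fun_pos[of j N0 T0 M0] by (auto simp: walk_count_0 pmf_return indicator_def)
next
  case (Suc n)
  let ?p = "pq_run j N0 T0 M0 n"
  let ?Z = "partition_fun j N0"
  have lt: "T0 + n < N0"
    using Suc.prems by simp
  have step: "pmf ?p M' * (?Z (Suc (T0 + n)) M / ?Z (T0 + n) M') =
      walk_count n M0 M' * ?Z (Suc (T0 + n)) M / ?Z T0 M0" for M'
    using Suc partition_fun_pos[of j N0 "T0 + n" M'] by simp
  have "pmf (pq_run j N0 T0 M0 (Suc n)) M =
        measure_pmf.expectation ?p (\<lambda>M'. pmf (pq_step j N0 (T0 + n) M') M)"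
    by (simp add: pmf_bind)
  \<comment> \<open>Only the two neighbours of \<open>M\<close> can precede it. After the
    intermediate \<open>Z\<close> cancels, the two terms match
    \<open>walk_count_Suc_inner\<close>.\<close>
  also have "\<dots> = (\<Sum>M'\<in>{M - 1, M + 1}. pmf (pq_step j N0 (T0 + n) M') M * pmf ?p M')"
    by (rule integral_measure_pmf_real)
      (auto simp: pmf_pq_step_partition_fun[OF lt] split: if_splits)
  also have "\<dots> = pmf ?p (M - 1) * (?Z (Suc (T0 + n)) M / ?Z (T0 + n) (M - 1))
      + pmf ?p (M + 1) * (?Z (Suc (T0 + n)) M / ?Z (T0 + n) (M + 1))"
    by (simp add: pmf_pq_step_partition_fun[OF lt] mult.commute)
  also have "\<dots> = walk_count (Suc n) M0 M * ?Z (T0 + Suc n) M / ?Z T0 M0"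
    unfolding step walk_count_Suc_inner by (simp add: add_divide_distrib distrib_right)
  finally show ?case .
qed

lemma pmf_pq_propagator:
  assumes "T0 \<le> T" "T \<le> N0"
  shows "pmf (pq_propagator j N0 T0 M0 T) M =
         walk_count (T - T0) M0 M * partition_fun j N0 T M / partition_fun j N0 T0 M0"
  using pmf_pq_run[of T0 "T - T0" N0 j M0 M] assms by (simp add: pq_propagator_def)

text \<open>Reweighting by positive partition functions does not change the support of the plain
  walk.\<close>

lemma set_pmf_pq_propagator:
  assumes "T0 \<le> T" "T \<le> N0"
  shows "set_pmf (pq_propagator j N0 T0 M0 T) =
    {M. \<bar>M - M0\<bar> \<le> int T - int T0 \<and> even (M - M0 + (int T - int T0))}"
proof -
  have "pmf (pq_propagator j N0 T0 M0 T) M = 0 \<longleftrightarrow> walk_count (T - T0) M0 M = 0" for M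
    using partition_fun_pos[of j N0 T M] partition_fun_pos[of j N0 T0 M0]
    by (simp add: pmf_pq_propagator[OF assms])
  then have "set_pmf (pq_propagator j N0 T0 M0 T) = {M. walk_count (T - T0) M0 M \<noteq> 0}"
    by (simp add: set_eq_iff set_pmf_iff)
  then show ?thesis
    by (simp only: walk_count_eq_0_iff of_nat_diff[OF assms(1)] not_not)
qed

section \<open>Attainable magnetizations and canonical probabilities of magnetization events\<close>

lemma mem_quenched_mags_iff: "M \<in> quenched_mags T \<longleftrightarrow> \<bar>M\<bar> \<le> int T \<and> even (M + int T)"
proof
  assume "M \<in> quenched_mags T"
  then obtain k where "M = 2 * int k - int T" "k \<le> T"
    unfolding quenched_mags_def by blast
  then show "\<bar>M\<bar> \<le> int T \<and> even (M + int T)"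
    by simp
next
  assume M: "\<bar>M\<bar> \<le> int T \<and> even (M + int T)"
  then obtain c where c: "M + int T = 2 * c"
    by (elim conjE evenE)
  with M have "0 \<le> c" "c \<le> int T"
    by linarith+
  with c have "M = 2 * int (nat c) - int T" "nat c \<le> T"
    by simp_all
  then show "M \<in> quenched_mags T"
    unfolding quenched_mags_def by blast
qed

text \<open>The three blocks are \<open>I\<close>, the rest of \<open>{1..T}\<close>, and the spins
  after \<open>T\<close>; the last block supplies the factor
  \<open>partition_fun j N0 T M\<close>.\<close>

lemma prob_gibbs_joint:
  assumes "N0 \<ge> 1" "T \<le> N0" "I \<subseteq> {1..T}"
  shows "measure_pmf.prob (gibbs j N0) {s. (\<Sum>i = 1..T. s i) = M \<and> (\<Sum>i\<in>I. s i) = M0} =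
    walk_count (card I) 0 M0 * walk_count (T - card I) M0 M * partition_fun j N0 T M
      / partition_fun j N0 0 0"
proof -
  have fin: "finite I"
    using assms(3) finite_subset by blast
  have un: "I \<union> ({1..T} - I) = {1..T}" "{1..T} \<union> {T<..N0} = {1..N0}"
    and disj: "{1..T} \<inter> {T<..N0} = {}"
    using assms by auto
  have card: "card ({1..T} - I) = T - card I"
    using card_Diff_subset[OF fin assms(3)] by simp
  show ?thesis
    using sum_PiE_three_blocks[of I "{1..T} - I" "{T<..N0}" M M0 "mag_weight j N0"] fin disj
    unfolding un prob_gibbs[OF assms(1)] spin_configs_def[symmetric] card
    by (simp add: partition_fun_def)
qed

text \<open>By exchangeability only the size of \<open>I\<close> matters. Dividing by the
  probability of the constraint cancels the count of configurations on \<open>I\<close> and leaves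
  the Doob formula of the propagator.\<close>

lemma cond_prob_gibbs:
  assumes "N0 \<ge> 1" "T \<le> N0" "I \<subseteq> {1..T}" "M0 \<in> quenched_mags (card I)"
  shows "\<P>(s in measure_pmf (gibbs j N0). (\<Sum>i = 1..T. s i) = M \<bar> (\<Sum>i\<in>I. s i) = M0) =
    pmf (pq_propagator j N0 (card I) M0 T) M"
proof -
  have fin: "finite I"
    using assms(3) finite_subset by blast
  have le: "card I \<le> T"
    using card_mono[OF _ assms(3)] by simp
  have sub: "I \<subseteq> {1..N0}"
    using assms by auto
  then have un: "I \<union> ({1..N0} - I) = {1..N0}"
    by auto
  have card: "card ({1..N0} - I) = N0 - card I"
    using card_Diff_subset[OF fin sub] by simp
  have "measure_pmf.prob (gibbs j N0) {s. (\<Sum>i\<in>I. s i) = M0} =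
      walk_count (card I) 0 M0 * partition_fun j N0 (card I) M0 / partition_fun j N0 0 0"
    using sum_PiE_two_blocks[of I "{1..N0} - I" M0 "mag_weight j N0"] fin
    unfolding un prob_gibbs[OF assms(1)] spin_configs_def[symmetric] card
    by (simp add: partition_fun_def)
  \<comment> \<open>Attainability of \<open>M0\<close> ensures that the conditioning event is not
    null, where \<open>cond_prob\<close> would be a division by zero.\<close>
  moreover have "walk_count (card I) 0 M0 \<noteq> 0"
    using assms(4) by (simp add: walk_count_eq_0_iff mem_quenched_mags_iff)
  ultimately show ?thesis
    using partition_fun_pos[of j N0 0 0] assms(2) le
    by (simp add: cond_prob_def prob_gibbs_joint[OF assms(1-3)] pmf_pq_propagator del: One_nat_def)
qed

text \<open>For empty \<open>I\<close> the constraint reads \<open>0 = 0\<close>, and the joint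
  formula reduces to that of the propagator started at 0.\<close>

lemma prob_gibbs_eq_pq_law_Unbiased:
  assumes "N0 \<ge> 1" "T \<le> N0"
  shows "measure_pmf.prob (gibbs j N0) {s. (\<Sum>i = 1..T. s i) = M} = pmf (pq_law j N0 Unbiased T) M"
  using prob_gibbs_joint[OF assms, of "{}" j M 0] assms(2)
  by (simp add: pmf_pq_propagator walk_count_0)

section \<open>Uniqueness of the unbiased start\<close>

lemma First_spin_law_determined:
  assumes "N0 \<ge> 1" "1 \<le> T" "T \<le> N0"
    and q: "set_pmf q \<subseteq> {-1, 1}"
    and eq: "pq_law j N0 (First_spin q) T = pq_law j N0 Unbiased T"
  shows "q = map_pmf (\<lambda>s. s 1) (gibbs j N0)"
proof (rule pmf_eqI)
  fix x
  let ?Z = "partition_fun j N0"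
  \<comment> \<open>The magnetization of a single spin is the spin itself, so the canonical law of
    \<open>s 1\<close> is the unbiased law at stage 1.\<close>
  have gibbs_1: "pmf (map_pmf (\<lambda>s. s 1) (gibbs j N0)) x = pmf (pq_law j N0 Unbiased 1) x"
    using prob_gibbs_eq_pq_law_Unbiased[of N0 1 j x] assms(1)
    by (simp add: pmf_map vimage_def)
  have "y \<in> {-1, 1}" if "\<bar>y\<bar> \<le> 1" "odd y" for y :: int
    using that by (cases "y = 0") auto
  then have supp: "set_pmf (pq_law j N0 Unbiased 1) \<subseteq> {-1, 1}"
    using assms(1) by (auto simp: set_pmf_pq_propagator)
  show "pmf q x = pmf (map_pmf (\<lambda>s. s 1) (gibbs j N0)) x"
  proof (cases "x \<in> {-1, 1}")
    case False
    then show ?thesis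
      unfolding gibbs_1 using q supp by (metis subsetD set_pmf_iff)
  next
    case True
    \<comment> \<open>Magnetization \<open>x * T\<close> requires every spin to equal
      \<open>x\<close>. At this value the mixture over first spins has a single term, and equality
      with the unbiased law can be solved for \<open>pmf q x\<close>.\<close>
    have other: "pmf (pq_propagator j N0 1 y T) (x * int T) = 0" if "y \<in> {-1, 1}" "y \<noteq> x" for y
    proof -
      have "x * int T \<notin> set_pmf (pq_propagator j N0 1 y T)"
        using that True assms(2,3) by (auto simp: set_pmf_pq_propagator)
      then show ?thesis by (simp add: set_pmf_iff)
    qed
    have "1 * ?Z T (x * int T) / ?Z 0 0 = pmf (pq_law j N0 Unbiased T) (x * int T)"
      using walk_count_extreme[OF True, of T 0] assms(3) by (simp add: pmf_pq_propagator)
    also have "\<dots> = measure_pmf.expectation q (\<lambda>y. pmf (pq_propagator j N0 1 y T) (x * int T))"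
      unfolding eq[symmetric] using assms(2) by (simp add: pmf_bind)
    also have "\<dots> = (\<Sum>y\<in>{x}. pmf (pq_propagator j N0 1 y T) (x * int T) * pmf q y)"
      using q other by (intro integral_measure_pmf_real) auto
    also have "\<dots> = ?Z T (x * int T) / ?Z 1 x * pmf q x"
    proof -
      have "x + x * int (T - 1) = x * int T"
        using assms(2) by (simp add: of_nat_diff algebra_simps)
      then show ?thesis
        using walk_count_extreme[OF True, of "T - 1" x] assms(2,3) by (simp add: pmf_pq_propagator)
    qed
    finally have "pmf q x = ?Z 1 x / ?Z 0 0"
      using partition_fun_pos[of j N0 T "x * int T"] partition_fun_pos[of j N0 1 x]
        partition_fun_pos[of j N0 0 0]
      by (simp add: field_simps)
    also have "\<dots> = pmf (pq_law j N0 Unbiased 1) x"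
      using walk_count_extreme[OF True, of 1 0] assms(1) by (simp add: pmf_pq_propagator)
    finally show ?thesis
      unfolding gibbs_1 .
  qed
qed

text \<open>The unbiased law charges both \<open>T\<close> and \<open>- T\<close>, which are
  \<open>2 * T\<close> apart. The prefixed law is a point mass or lives on an interval of width
  \<open>2 * (T - length xs)\<close>, which is too short.\<close>

lemma Prefixed_law_neq_Unbiased:
  assumes "1 \<le> T" "T \<le> N0" "xs \<noteq> []"
  shows "pq_law j N0 (Prefixed xs) T \<noteq> pq_law j N0 Unbiased T"
proof
  assume eq: "pq_law j N0 (Prefixed xs) T = pq_law j N0 Unbiased T"
  have "{int T, - int T} \<subseteq> set_pmf (pq_law j N0 Unbiased T)"
    using assms(2) by (auto simp: set_pmf_pq_propagator)
  then have both: "{int T, - int T} \<subseteq> set_pmf (pq_law j N0 (Prefixed xs) T)"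
    unfolding eq .
  show False
  proof (cases "T \<le> length xs")
    case True
    then show False using both assms(1) by auto
  next
    case False
    moreover have "length xs \<ge> 1"
      using assms(3) by (cases xs) auto
    ultimately show False
      using both assms(1,2) by (auto simp: set_pmf_pq_propagator)
  qed
qed

lemma pq_law_eq_Unbiased_iff:
  assumes "N0 \<ge> 1" "1 \<le> T" "T \<le> N0" "admissible_start j N0 st"
  shows "pq_law j N0 st T = pq_law j N0 Unbiased T \<longleftrightarrow> st = Unbiased"
proof (cases st)
  case (First_spin q)
  then show ?thesis
    using First_spin_law_determined[OF assms(1-3), of q j] assms(4) by auto
next
  case (Prefixed xs)
  then show ?thesis
    using Prefixed_law_neq_Unbiased[OF assms(2,3), of xs j] assms(4) by auto
qed simp

theorem mainTheorem4:
  fixes N0 :: nat and j :: real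
  assumes "N0 \<ge> 1"
  shows
    "(\<forall>st. admissible_start j N0 st \<longrightarrow>
        ((\<forall>T\<le>N0. \<forall>M. pmf (pq_law j N0 st T) M
            = measure_pmf.prob (gibbs j N0) {s. (\<Sum>i = 1..T. s i) = M})
          \<longleftrightarrow> st = Unbiased)
      \<and> (\<forall>T\<in>{1..N0}.
          (\<forall>M. pmf (pq_law j N0 st T) M
            = measure_pmf.prob (gibbs j N0) {s. (\<Sum>i = 1..T. s i) = M})
          \<longleftrightarrow> st = Unbiased))
   \<and> (\<forall>T0 T M0. T0 \<le> T \<longrightarrow> T \<le> N0 \<longrightarrow> M0 \<in> quenched_mags T0 \<longrightarrow>
        (\<forall>ix :: nat \<Rightarrow> nat. inj_on ix {1..T0} \<longrightarrow> ix ` {1..T0} \<subseteq> {1..T} \<longrightarrow>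
          (\<forall>M. pmf (pq_propagator j N0 T0 M0 T) M
            = \<P>(s in measure_pmf (gibbs j N0).
                (\<Sum>i = 1..T. s i) = M \<bar> (\<Sum>l = 1..T0. s (ix l)) = M0)))
      \<and> set_pmf (pq_propagator j N0 T0 M0 T)
          = {M \<in> quenched_mags T. \<bar>M - M0\<bar> \<le> int T - int T0})"
proof (intro conjI allI impI ballI)
  fix st
  assume st: "admissible_start j N0 st"
  \<comment> \<open>Each stage from 1 on identifies the start by itself. Stage 0 cannot, because
    every start gives the point mass at 0 there.\<close>
  have stage: "(\<forall>M. pmf (pq_law j N0 st T) M
        = measure_pmf.prob (gibbs j N0) {s. (\<Sum>i = 1..T. s i) = M}) \<longleftrightarrow> st = Unbiased"
    if "T \<in> {1..N0}" for T
    using that pq_law_eq_Unbiased_iff[OF assms _ _ st, of T]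
    by (simp add: prob_gibbs_eq_pq_law_Unbiased[OF assms] pmf_eq_iff del: pq_law.simps One_nat_def)
  show "(\<forall>T\<le>N0. \<forall>M. pmf (pq_law j N0 st T) M
        = measure_pmf.prob (gibbs j N0) {s. (\<Sum>i = 1..T. s i) = M}) \<longleftrightarrow> st = Unbiased"
  proof
    assume "\<forall>T\<le>N0. \<forall>M. pmf (pq_law j N0 st T) M
        = measure_pmf.prob (gibbs j N0) {s. (\<Sum>i = 1..T. s i) = M}"
    \<comment> \<open>One stage suffices, and \<open>N0\<close> is available since it is at least
      1.\<close>
    then show "st = Unbiased"
      using stage[of N0] assms by (simp del: One_nat_def)
  next
    assume "st = Unbiased"
    then show "\<forall>T\<le>N0. \<forall>M. pmf (pq_law j N0 st T) M
        = measure_pmf.prob (gibbs j N0) {s. (\<Sum>i = 1..T. s i) = M}"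
      by (simp add: prob_gibbs_eq_pq_law_Unbiased[OF assms] del: pq_law.simps One_nat_def)
  qed
  show "(\<forall>M. pmf (pq_law j N0 st T) M
        = measure_pmf.prob (gibbs j N0) {s. (\<Sum>i = 1..T. s i) = M}) \<longleftrightarrow> st = Unbiased"
    if "T \<in> {1..N0}" for T
    using that by (rule stage)
next
  fix T0 T :: nat and M0 :: int and ix :: "nat \<Rightarrow> nat" and M :: int
  assume "T \<le> N0" "M0 \<in> quenched_mags T0"
    and inj: "inj_on ix {1..T0}" and "ix ` {1..T0} \<subseteq> {1..T}"
  then show "pmf (pq_propagator j N0 T0 M0 T) M
      = \<P>(s in measure_pmf (gibbs j N0).
          (\<Sum>i = 1..T. s i) = M \<bar> (\<Sum>l = 1..T0. s (ix l)) = M0)"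
    using cond_prob_gibbs[OF assms, of T "ix ` {1..T0}" M0 j M]
    by (simp add: card_image[OF inj] sum.reindex[OF inj] comp_def del: One_nat_def)
next
  fix T0 T :: nat and M0 :: int
  assume le: "T0 \<le> T" "T \<le> N0" and "M0 \<in> quenched_mags T0"
  then have M0: "\<bar>M0\<bar> \<le> int T0" "even (M0 + int T0)"
    by (simp_all add: mem_quenched_mags_iff)
  \<comment> \<open>Since \<open>M0\<close> has the parity of \<open>T0\<close>, the parity
    condition relative to the start is the absolute one in \<open>quenched_mags T\<close>; the bound
    by \<open>T\<close> then follows from the triangle inequality.\<close>
  have "even (M - M0 + (int T - int T0)) \<longleftrightarrow> even (M + int T)" for M
  proof -
    have "M - M0 + (int T - int T0) = (M + int T) - (M0 + int T0)"
      by simp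
    then show ?thesis
      using M0(2) by (metis even_diff even_add)
  qed
  moreover have "\<bar>M\<bar> \<le> int T" if "\<bar>M - M0\<bar> \<le> int T - int T0" for M
    using that M0(1) by linarith
  ultimately show "set_pmf (pq_propagator j N0 T0 M0 T)
      = {M \<in> quenched_mags T. \<bar>M - M0\<bar> \<le> int T - int T0}"
    by (auto simp: set_pmf_pq_propagator[OF le] mem_quenched_mags_iff)
qed

end
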